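(* Let $\varrho$ be a state (density matrix) of rank $r$ on $\mathbb{C}^m\otimes\mathbb{C}^n$. Fix a subnormalized eigenensemble $\{|e_\alpha\rangle\}_{\alpha=1}^r$ of $\varrho$, and for a complex $m^2n^2\times r$ matrix $z=(z_{i\alpha})$ put $|\psi_i\rangle:=\sum_{\alpha=1}^r z_{i\alpha}|e_\alpha\rangle$, $i=1,\dots,m^2n^2$. Then $\varrho$ is separable if and only if the following system of equations possesses a solution $z$: $$E_\varrho(z):=\sum_{i=1}^{m^2n^2}c^2(\psi_i)=\sum_{i=1}^{m^2n^2}\ \sum_{\alpha,\beta,\mu,\nu=1}^r \overline{z_{i\alpha}}\;\overline{z_{i\beta}}\,E^\varrho_{\alpha\beta\mu\nu}\,z_{i\mu}z_{i\nu}=0,$$ $$\mathcal{C}_{\alpha\beta}(z):=\sum_{i=1}^{m^2n^2}\overline{z_{i\alpha}}z_{i\beta}-\delta_{\alpha\beta}=0\qquad\text{for all }\alpha,\beta=1,\dots,r,$$ where $$E^\varrho_{\alpha\beta\mu\nu}:=\frac{1}{4}\,\langle e_\alpha\otimes e_\beta\,|\,\Pi_m\otimes\Pi_n\,e_\mu\otimes e_\nu\rangle$$ and $\Pi_m$, $\Pi_n$ are the projectors from $\mathbb{C}^m\otimes\mathbb{C}^m$, $\mathbb{C}^n\otimes\mathbb{C}^n$ onto the skew-symmetric subspaces $\mathbb{C}^m\wedge\mathbb{C}^m$, $\mathbb{C}^n\wedge\mathbb{C}^n$, respectively.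
   Context: Write $\mathcal{H}_A=\mathbb{C}^m$, $\mathcal{H}_B=\mathbb{C}^n$. Inner products are conjugate-linear in the first argument. A state is a positive semidefinite operator of trace one. Separability: a state $\varrho$ on $\mathcal{H}_A\otimes\mathcal{H}_B$ is separable if there exists a convex decomposition of it composed entirely of product vectors, i.e. there exist a finite $N$, probabilities $p_i\ge 0$ with $\sum_i p_i=1$, and unit vectors $|x_i\rangle\in\mathcal{H}_A$, $|y_i\rangle\in\mathcal{H}_B$ such that $\varrho=\sum_{i=1}^N p_i\,|x_i\rangle\langle x_i|\otimes|y_i\rangle\langle y_i|$. Subnormalized eigenensemble: pairwise orthogonal eigenvectors $|e_1\rangle,\dots,|e_r\rangle$ of $\varrho$ corresponding to its non-zero eigenvalues $\lambda_1,\dots,\lambda_r$ (listed with multiplicity), scaled so that $\langle e_\alpha|e_\alpha\rangle=\lambda_\alpha$; thus $\varrho=\sum_{\alpha=1}^r|e_\alpha\rangle\langle e_\alpha|$. Squared generalized concurrence: for any (not necessarily normalized) vector $|\psi\rangle\in\mathcal{H}_A\otimes\mathcal{H}_B$, $$c^2(\psi):=\|\psi\|^4-\mathrm{tr}_{\mathcal{H}_A}\big[(\mathrm{tr}_{\mathcal{H}_B}|\psi\rangle\langle\psi|)^2\big].$$ Tensor-factor convention: $e_\alpha\otimes e_\beta$ lies in $(\mathcal{H}_A\otimes\mathcal{H}_B)\otimes(\mathcal{H}_{A'}\otimes\mathcal{H}_{B'})$, where $\mathcal{H}_{A'}$, $\mathcal{H}_{B'}$ are second copies of $\mathcal{H}_A$,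 $\mathcal{H}_B$. The operator $\Pi_m\otimes\Pi_n$ acts with $\Pi_m$ on the pair $\mathcal{H}_A\otimes\mathcal{H}_{A'}\cong\mathbb{C}^m\otimes\mathbb{C}^m$ and with $\Pi_n$ on the pair $\mathcal{H}_B\otimes\mathcal{H}_{B'}\cong\mathbb{C}^n\otimes\mathbb{C}^n$ (after the canonical reordering of the tensor factors).
   Formalization: The displayed equality of the sum of c²(ψ_i) with the quartic form is off by a factor (Bell state: 1/2 versus 1/16); the formal theorem states that the sum of c² equals 8 times the quartic form, and proves the separability criterion for each of the two expressions. *)

theory Defs
  imports "HOL-Analysis.Analysis"
begin

text \<open>
  The space \<open>\<complex>\<^sup>m \<otimes> \<complex>\<^sup>n\<close> is rendered as \<open>complex^('m \<times> 'n)\<close>, the component at \<open>(i, j)\<close> being the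
  coefficient of the product basis vector number \<open>i, j\<close>; operators are square matrices over the
  same index type.
\<close>

definition cinner :: "complex^'k \<Rightarrow> complex^'k \<Rightarrow> complex"
  where "cinner x y = (\<Sum>i\<in>UNIV. cnj (x $ i) * y $ i)"

definition adjoint_mat :: "complex^'k^'l \<Rightarrow> complex^'l^'k"
  where "adjoint_mat A = (\<chi> i j. cnj (A $ j $ i))"

definition hermitian_mat :: "complex^'k^'k \<Rightarrow> bool"
  where "hermitian_mat A \<longleftrightarrow> adjoint_mat A = A"

definition pos_semidef :: "complex^'k^'k \<Rightarrow> bool"
  where "pos_semidef A \<longleftrightarrow> hermitian_mat A \<and> (\<forall>v. 0 \<le> Re (cinner v (A *v v)))"

definition is_state :: "complex^'k^'k \<Rightarrow> bool"
  where "is_state \<rho> \<longleftrightarrow> pos_semidef \<rho> \<and> trace \<rho> = 1"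

text \<open>The operator \<open>|x\<rangle>\<langle>x|\<close>.\<close>

definition ketbra :: "complex^'k \<Rightarrow> complex^'k^'k"
  where "ketbra x = (\<chi> i j. x $ i * cnj (x $ j))"

definition tensor_vec :: "complex^'k \<Rightarrow> complex^'l \<Rightarrow> complex^('k::finite \<times> 'l::finite)"
  where "tensor_vec x y = (\<chi> p. x $ fst p * y $ snd p)"

definition tensor_mat :: "complex^'k^'k \<Rightarrow> complex^'l^'l \<Rightarrow> complex^('k::finite \<times> 'l::finite)^('k \<times> 'l)"
  where "tensor_mat A B = (\<chi> p q. A $ fst p $ fst q * B $ snd p $ snd q)"

definition separable_state :: "complex^('m::finite \<times> 'n::finite)^('m \<times> 'n) \<Rightarrow> bool"
  where "separable_state \<rho> \<longleftrightarrow>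
    (\<exists>(N::nat) (p::nat \<Rightarrow> real) (x::nat \<Rightarrow> complex^'m) (y::nat \<Rightarrow> complex^'n).
       (\<forall>i<N. p i \<ge> 0 \<and> norm (x i) = 1 \<and> norm (y i) = 1) \<and> (\<Sum>i<N. p i) = 1 \<and>
       \<rho> = (\<Sum>i<N. p i *\<^sub>R tensor_mat (ketbra (x i)) (ketbra (y i))))"

text \<open>
  The last conjunct says that every non-zero eigenvalue is listed with its multiplicity
  (\<^const>\<open>vec.dim\<close> is the dimension over the complex field).
\<close>

definition subnormalized_eigenensemble ::
    "complex^'k^'k \<Rightarrow> nat \<Rightarrow> (nat \<Rightarrow> complex^'k) \<Rightarrow> bool"
  where "subnormalized_eigenensemble \<rho> r e \<longleftrightarrow>
    (\<exists>l::nat \<Rightarrow> complex.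
       (\<forall>\<alpha><r. l \<alpha> \<noteq> 0 \<and> \<rho> *v e \<alpha> = l \<alpha> *s e \<alpha> \<and> cinner (e \<alpha>) (e \<alpha>) = l \<alpha>) \<and>
       (\<forall>\<alpha><r. \<forall>\<beta><r. \<alpha> \<noteq> \<beta> \<longrightarrow> cinner (e \<alpha>) (e \<beta>) = 0) \<and>
       (\<forall>\<mu>. \<mu> \<noteq> 0 \<longrightarrow> card {\<alpha>. \<alpha> < r \<and> l \<alpha> = \<mu>} = vec.dim {v. \<rho> *v v = \<mu> *s v}))"

definition partial_trace_B :: "complex^('m::finite \<times> 'n::finite)^('m \<times> 'n) \<Rightarrow> complex^'m^'m"
  where "partial_trace_B A = (\<chi> i j. \<Sum>k\<in>UNIV. A $ (i, k) $ (j, k))"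

definition concurrence_sq :: "complex^('m::finite \<times> 'n::finite) \<Rightarrow> complex"
  where "concurrence_sq \<psi> = complex_of_real (norm \<psi> ^ 4)
    - trace (partial_trace_B (ketbra \<psi>) ** partial_trace_B (ketbra \<psi>))"

definition skew_subspace :: "(complex^('k::finite \<times> 'k)) set"
  where "skew_subspace = {v. \<forall>i j. v $ (i, j) = - v $ (j, i)}"

definition orth_projector_onto :: "complex^'k^'k \<Rightarrow> (complex^'k) set \<Rightarrow> bool"
  where "orth_projector_onto P S \<longleftrightarrow> hermitian_mat P \<and> P ** P = P \<and> range ((*v) P) = S"

definition skew_projector :: "complex^('k::finite \<times> 'k)^('k \<times> 'k)"
  where "skew_projector = (THE P. orth_projector_onto P skew_subspace)"

text \<open>
  The canonical reordering
  \<open>(H\<^sub>A \<otimes> H\<^sub>B) \<otimes> (H\<^sub>A \<otimes> H\<^sub>B) \<cong> (H\<^sub>A \<otimes> H\<^sub>A) \<otimes> (H\<^sub>B \<otimes> H\<^sub>B)\<close>.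
\<close>

definition reorder ::
    "complex^(('m::finite \<times> 'n::finite) \<times> ('m \<times> 'n)) \<Rightarrow> complex^(('m \<times> 'm) \<times> ('n \<times> 'n))"
  where "reorder v = vec_lambda (\<lambda>((a, a'), (b, b')). v $ ((a, b), (a', b')))"

definition E_coeff :: "(nat \<Rightarrow> complex^('m::finite \<times> 'n::finite)) \<Rightarrow> nat \<Rightarrow> nat \<Rightarrow> nat \<Rightarrow> nat \<Rightarrow> complex"
  where "E_coeff e \<alpha> \<beta> \<mu> \<nu> = 1 / 4 *
    cinner (reorder (tensor_vec (e \<alpha>) (e \<beta>)))
      (tensor_mat (skew_projector :: complex^('m \<times> 'm)^('m \<times> 'm))
                  (skew_projector :: complex^('n \<times> 'n)^('n \<times> 'n))
        *v reorder (tensor_vec (e \<mu>) (e \<nu>)))"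

definition ensemble_vec ::
    "(nat \<Rightarrow> complex^'k) \<Rightarrow> nat \<Rightarrow> (nat \<Rightarrow> nat \<Rightarrow> complex) \<Rightarrow> nat \<Rightarrow> complex^'k"
  where "ensemble_vec e r z i = (\<Sum>\<alpha><r. z i \<alpha> *s e \<alpha>)"

definition E_concurrence ::
    "(nat \<Rightarrow> complex^('m::finite \<times> 'n::finite)) \<Rightarrow> nat \<Rightarrow> (nat \<Rightarrow> nat \<Rightarrow> complex) \<Rightarrow> complex"
  where "E_concurrence e r z =
    (\<Sum>i<CARD('m)\<^sup>2 * CARD('n)\<^sup>2. concurrence_sq (ensemble_vec e r z i))"

text \<open>
  For a vector \<open>\<psi>\<close> and the orthogonal projectors \<open>\<Pi>\<close>, \<open>\<langle>\<psi> \<otimes> \<psi> | \<Pi> \<otimes> \<Pi> | \<psi> \<otimes> \<psi>\<rangle>\<close> is half of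
  \<^const>\<open>concurrence_sq\<close>; with the factor \<open>1 / 4\<close> of \<^const>\<open>E_coeff\<close>, the following form is
  therefore one eighth of \<^const>\<open>E_concurrence\<close>.
\<close>

definition E_quartic ::
    "(nat \<Rightarrow> complex^('m::finite \<times> 'n::finite)) \<Rightarrow> nat \<Rightarrow> (nat \<Rightarrow> nat \<Rightarrow> complex) \<Rightarrow> complex"
  where "E_quartic e r z =
    (\<Sum>i<CARD('m)\<^sup>2 * CARD('n)\<^sup>2. \<Sum>\<alpha><r. \<Sum>\<beta><r. \<Sum>\<mu><r. \<Sum>\<nu><r.
       cnj (z i \<alpha>) * cnj (z i \<beta>) * E_coeff e \<alpha> \<beta> \<mu> \<nu> * z i \<mu> * z i \<nu>)"

text \<open>The description in \<^const>\<open>skew_projector\<close> is proper:\<close>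

lemma orth_projector_onto_unique:
  assumes "orth_projector_onto P S" "orth_projector_onto Q S"
  shows "P = Q"
proof -
  have absorb: "B ** A = A" if "orth_projector_onto A S" "orth_projector_onto B S"
    for A B :: "complex^'a^'a"
  proof -
    have "B *v (A *v v) = A *v v" for v
    proof -
      have "A *v v \<in> range ((*v) B)"
        using that by (auto simp: orth_projector_onto_def)
      then obtain w where w: "A *v v = B *v w" by auto
      show ?thesis
        using that(2) by (simp add: w matrix_vector_mul_assoc orth_projector_onto_def)
    qed
    then show ?thesis by (simp add: matrix_eq matrix_vector_mul_assoc[symmetric])
  qed
  have adj: "adjoint_mat (A ** B) = adjoint_mat B ** adjoint_mat A" for A B :: "complex^'a^'a"
    by (simp add: adjoint_mat_def matrix_matrix_mult_def vec_eq_iff mult.commute)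
  have "P = adjoint_mat (Q ** P)"
    using absorb[OF assms] assms(1) by (simp add: orth_projector_onto_def hermitian_mat_def)
  also have "\<dots> = P ** Q"
    using assms by (simp add: adj orth_projector_onto_def hermitian_mat_def)
  also have "\<dots> = Q"
    using absorb[OF assms(2,1)] .
  finally show ?thesis .
qed

lemma orth_projector_onto_skew_subspace:
  "orth_projector_onto
     (\<chi> p q. ((if p = q then 1 else 0) - (if p = prod.swap q then 1 else 0)) / 2 ::
        complex^('k::finite \<times> 'k)^('k \<times> 'k)) skew_subspace"
    (is "orth_projector_onto ?P _")
proof -
  define P :: "complex^('k \<times> 'k)^('k \<times> 'k)" where "P = ?P"
  have swap_iff: "p = prod.swap q \<longleftrightarrow> q = prod.swap p" for p q :: "'k \<times> 'k"
    by (metis swap_swap)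
  have entry: "P $ p $ q = ((if q = p then 1 else 0) - (if q = prod.swap p then 1 else 0)) / 2"
    for p q
    unfolding P_def vec_lambda_beta swap_iff[of p q] eq_commute[of p q] ..
  have app: "(P *v v) $ p = (v $ p - v $ prod.swap p) / 2" for v p
  proof -
    have "P $ p $ q * v $ q =
        (if q = p then v $ q / 2 else 0) - (if q = prod.swap p then v $ q / 2 else 0)" for q
      unfolding entry by simp
    then have "(P *v v) $ p = (\<Sum>q\<in>UNIV.
        (if q = p then v $ q / 2 else 0) - (if q = prod.swap p then v $ q / 2 else 0))"
      by (simp only: matrix_vector_mult_def vec_lambda_beta)
    also have "\<dots> = v $ p / 2 - v $ prod.swap p / 2"
      by (simp only: sum_subtractf sum.delta finite UNIV_I if_True)
    finally show ?thesis by (simp only: diff_divide_distrib)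
  qed
  have "cnj (P $ q $ p) = P $ p $ q" for p q
    unfolding entry swap_iff[of p q] eq_commute[of p q] by simp
  then have herm: "hermitian_mat P"
    by (simp only: hermitian_mat_def adjoint_mat_def vec_eq_iff vec_lambda_beta simp_thms)
  have fix_skew: "P *v v = v" if "v \<in> skew_subspace" for v
  proof -
    have "v $ prod.swap p = - v $ p" for p
    proof (cases p)
      case (Pair i j)
      have "v $ (j, i) = - v $ (i, j)"
        using that unfolding skew_subspace_def by blast
      then show ?thesis by (simp only: Pair swap_simp)
    qed
    then have "(P *v v) $ p = v $ p" for p
      by (simp only: app) simp
    then show ?thesis by (simp only: vec_eq_iff simp_thms)
  qed
  have in_skew: "P *v v \<in> skew_subspace" for v
    by (simp add: skew_subspace_def app diff_divide_distrib)
  have "P *v (P *v v) = P *v v" for v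
    by (rule fix_skew[OF in_skew])
  then have "P ** P = P"
    unfolding matrix_eq matrix_vector_mul_assoc[symmetric] by blast
  moreover have "range ((*v) P) = skew_subspace"
  proof (intro subset_antisym subsetI)
    fix v assume "v \<in> range ((*v) P)"
    then obtain w where "v = P *v w" by (rule imageE)
    then show "v \<in> skew_subspace" by (rule ssubst) (rule in_skew)
  next
    fix v :: "complex^('k \<times> 'k)" assume "v \<in> skew_subspace"
    from fix_skew[OF this, symmetric] show "v \<in> range ((*v) P)"
      by (rule range_eqI)
  qed
  ultimately have "orth_projector_onto P skew_subspace"
    using herm by (simp only: orth_projector_onto_def simp_thms)
  then show ?thesis by (simp only: P_def)
qed

lemma orth_projector_onto_skew_projector:
  "orth_projector_onto skew_projector skew_subspace"
  unfolding skew_projector_def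
  by (rule theI[where P = "\<lambda>P. orth_projector_onto P skew_subspace",
        OF orth_projector_onto_skew_subspace])
    (rule orth_projector_onto_unique[OF _ orth_projector_onto_skew_subspace])

end

theory Submission
  imports Defs
begin

text \<open>
  \<open>c\<^sup>2(\<psi>)\<close> is half the sum of the squared moduli of all \<open>2 \<times> 2\<close> minors of the coefficient matrix of
  \<open>\<psi>\<close>, so it vanishes exactly on product vectors; \<open>\<Pi>\<^sub>m \<otimes> \<Pi>\<^sub>n\<close> maps \<open>\<psi> \<otimes> \<psi>\<close> to half of these minors.
  The decompositions \<open>\<rho> = \<Sum>\<^sub>i |\<psi>\<^sub>i\<rangle>\<langle>\<psi>\<^sub>i|\<close> are exactly the families \<open>\<psi>\<^sub>i = \<Sum>\<^sub>\<alpha> z\<^sub>i\<^sub>\<alpha> e\<^sub>\<alpha>\<close> with \<open>z\<close>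
  an isometry. Finally, \<open>m\<^sup>2n\<^sup>2\<close> product vectors are enough by Caratheodory's theorem, since the Hermitian
  matrices of trace one form an affine space of real dimension \<open>m\<^sup>2n\<^sup>2 - 1\<close>.
\<close>

section \<open>Inner products, rank-one operators and tensor products\<close>

lemma sum_UNIV_prod:
  "(\<Sum>p\<in>UNIV. f p) = (\<Sum>a\<in>UNIV. \<Sum>b\<in>UNIV. f (a, b))"
  by (simp add: sum.cartesian_product)

lemma cinner_scale_right: "cinner x (c *s y) = c * cinner x y"
  by (simp add: cinner_def sum_distrib_left ac_simps)

lemma cinner_scale_left: "cinner (c *s x) y = cnj c * cinner x y"
  by (simp add: cinner_def sum_distrib_left ac_simps)

lemma cinner_diff_right: "cinner x (y - z) = cinner x y - cinner x z"
  by (simp add: cinner_def algebra_simps sum_subtractf)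

lemma cinner_sum_right: "cinner x (\<Sum>i\<in>S. f i) = (\<Sum>i\<in>S. cinner x (f i))"
  by (simp add: cinner_def sum_distrib_left) (rule sum.swap)

lemma cinner_sum_left: "cinner (\<Sum>i\<in>S. f i) x = (\<Sum>i\<in>S. cinner (f i) x)"
  by (simp add: cinner_def sum_distrib_right) (rule sum.swap)

lemma cinner_zero_right [simp]: "cinner x 0 = 0"
  by (simp add: cinner_def)

lemma cnj_cinner: "cnj (cinner x y) = cinner y x"
  by (simp add: cinner_def mult.commute)

lemma cinner_self: "cinner x x = complex_of_real ((norm x)\<^sup>2)"
  by (simp add: cinner_def norm_vec_def L2_set_def sum_nonneg complex_norm_square mult.commute
      del: of_real_power)

lemma cinner_self_eq_0_iff: "cinner x x = 0 \<longleftrightarrow> x = 0"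
  by (simp add: cinner_self)

lemma ketbra_mult_vec: "ketbra x *v v = cinner x v *s x"
  by (simp add: ketbra_def cinner_def matrix_vector_mult_def vec_eq_iff sum_distrib_left ac_simps)

lemma sum_mat_mult_vec:
  fixes f :: "'i \<Rightarrow> complex^'k^'l"
  shows "(\<Sum>i\<in>S. f i) *v v = (\<Sum>i\<in>S. f i *v v)"
  by (induction S rule: infinite_finite_induct) (simp_all add: matrix_vector_mult_add_rdistrib)

lemma mat_mult_vec_sum:
  fixes M :: "complex^'k^'l"
  shows "M *v (\<Sum>i\<in>S. f i) = (\<Sum>i\<in>S. M *v f i)"
  by (induction S rule: infinite_finite_induct) (simp_all add: matrix_vector_right_distrib)

lemma trace_sum: "trace (\<Sum>i\<in>S. f i) = (\<Sum>i\<in>S. trace (f i :: complex^'k^'k))"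
  by (simp add: trace_def) (rule sum.swap)

lemma trace_scaleR: "trace (c *\<^sub>R M) = c *\<^sub>R trace (M :: complex^'k^'k)"
  by (simp add: trace_def scaleR_right.sum)

lemma trace_ketbra: "trace (ketbra x) = complex_of_real ((norm x)\<^sup>2)"
  unfolding cinner_self[symmetric] by (simp add: trace_def ketbra_def cinner_def mult.commute)

lemma hermitian_ketbra: "hermitian_mat (ketbra x)"
  by (simp add: hermitian_mat_def adjoint_mat_def ketbra_def vec_eq_iff)

lemma ketbra_scaleR: "ketbra (c *\<^sub>R x) = c\<^sup>2 *\<^sub>R ketbra x"
  by (simp add: ketbra_def vec_eq_iff power2_eq_square)

lemma tensor_mat_ketbra: "tensor_mat (ketbra x) (ketbra y) = ketbra (tensor_vec x y)"
  by (simp add: tensor_mat_def ketbra_def tensor_vec_def vec_eq_iff)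

lemma cinner_tensor_vec:
  "cinner (tensor_vec x y) (tensor_vec u v) = cinner x u * cinner y v"
  by (simp add: cinner_def tensor_vec_def sum_UNIV_prod sum_product ac_simps)

lemma norm_tensor_vec: "norm (tensor_vec x y) = norm x * norm y"
proof -
  have "complex_of_real ((norm (tensor_vec x y))\<^sup>2) = complex_of_real ((norm x * norm y)\<^sup>2)"
    using cinner_tensor_vec[of x y x y] by (simp add: cinner_self power_mult_distrib)
  then show ?thesis
    unfolding of_real_eq_iff by (simp add: power2_eq_iff_nonneg)
qed

section \<open>Concurrence\<close>

definition minor :: "complex^('m::finite \<times> 'n::finite) \<Rightarrow> 'm \<Rightarrow> 'm \<Rightarrow> 'n \<Rightarrow> 'n \<Rightarrow> complex"
  where "minor \<psi> a a' b b' = \<psi> $ (a, b) * \<psi> $ (a', b') - \<psi> $ (a', b) * \<psi> $ (a, b')"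

text \<open>Both \<open>norm \<psi> ^ 4\<close> and the purity of the reduced operator expand over
  the same four indices with the same conjugated factor; the remaining factors differ by a
  minor.\<close>

lemma concurrence_sq_eq_sum:
  "concurrence_sq \<psi> =
    (\<Sum>a\<in>UNIV. \<Sum>a'\<in>UNIV. \<Sum>b\<in>UNIV. \<Sum>b'\<in>UNIV.
      cnj (\<psi> $ (a, b) * \<psi> $ (a', b')) * minor \<psi> a a' b b')"
proof -
  have "complex_of_real (norm \<psi> ^ 4) = cinner \<psi> \<psi> * cinner \<psi> \<psi>"
    unfolding cinner_self of_real_mult[symmetric] by (simp add: power4_eq_xxxx power2_eq_square)
  also have "\<dots> = (\<Sum>a\<in>UNIV. \<Sum>a'\<in>UNIV. \<Sum>b\<in>UNIV. \<Sum>b'\<in>UNIV.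
      cnj (\<psi> $ (a, b) * \<psi> $ (a', b')) * (\<psi> $ (a, b) * \<psi> $ (a', b')))"
    by (simp add: cinner_def sum_UNIV_prod sum_product ac_simps)
  finally have 1: "complex_of_real (norm \<psi> ^ 4) = \<dots>" .
  have "trace (partial_trace_B (ketbra \<psi>) ** partial_trace_B (ketbra \<psi>)) =
    (\<Sum>a\<in>UNIV. \<Sum>a'\<in>UNIV. (\<Sum>b\<in>UNIV. \<psi> $ (a', b) * cnj (\<psi> $ (a, b))) *
       (\<Sum>b\<in>UNIV. \<psi> $ (a, b) * cnj (\<psi> $ (a', b))))"
    by (simp add: trace_def matrix_matrix_mult_def partial_trace_B_def ketbra_def mult.commute)
  also have "\<dots> = (\<Sum>a\<in>UNIV. \<Sum>a'\<in>UNIV. \<Sum>b\<in>UNIV. \<Sum>b'\<in>UNIV.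
      cnj (\<psi> $ (a, b) * \<psi> $ (a', b')) * (\<psi> $ (a', b) * \<psi> $ (a, b')))"
    unfolding sum_product by (intro sum.cong refl) simp
  finally show ?thesis
    unfolding concurrence_sq_def 1
    by (simp add: minor_def right_diff_distrib sum_subtractf)
qed

text \<open>A minor changes sign when \<open>a\<close> and \<open>a'\<close> are exchanged, so
  adding the previous sum to its copy with these indices exchanged completes each term to a squared
  modulus.\<close>

lemma concurrence_sq_eq_minors:
  "concurrence_sq \<psi> = complex_of_real
    ((\<Sum>a\<in>UNIV. \<Sum>a'\<in>UNIV. \<Sum>b\<in>UNIV. \<Sum>b'\<in>UNIV. (cmod (minor \<psi> a a' b b'))\<^sup>2) / 2)"
proof -
  have swapped: "concurrence_sq \<psi> =
    (\<Sum>a\<in>UNIV. \<Sum>a'\<in>UNIV. \<Sum>b\<in>UNIV. \<Sum>b'\<in>UNIV.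
      cnj (\<psi> $ (a', b) * \<psi> $ (a, b')) * minor \<psi> a' a b b')"
    unfolding concurrence_sq_eq_sum by (rule sum.swap)
  have "concurrence_sq \<psi> + concurrence_sq \<psi> =
    (\<Sum>a\<in>UNIV. \<Sum>a'\<in>UNIV. \<Sum>b\<in>UNIV. \<Sum>b'\<in>UNIV.
      cnj (\<psi> $ (a, b) * \<psi> $ (a', b')) * minor \<psi> a a' b b' +
      cnj (\<psi> $ (a', b) * \<psi> $ (a, b')) * minor \<psi> a' a b b')"
    unfolding sum.distrib by (rule arg_cong2[where f = "(+)", OF concurrence_sq_eq_sum swapped])
  also have "\<dots> = (\<Sum>a\<in>UNIV. \<Sum>a'\<in>UNIV. \<Sum>b\<in>UNIV. \<Sum>b'\<in>UNIV.
      complex_of_real ((cmod (minor \<psi> a a' b b'))\<^sup>2))"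
    by (intro sum.cong refl) (simp only: complex_norm_square minor_def, simp add: algebra_simps)
  finally show ?thesis
    by (simp add: mult.commute)
qed

lemma concurrence_sq_eq_0_iff_minors:
  "concurrence_sq \<psi> = 0 \<longleftrightarrow> (\<forall>a a' b b'. minor \<psi> a a' b b' = 0)"
  by (simp add: concurrence_sq_eq_minors sum_nonneg_eq_0_iff sum_nonneg del: of_real_sum)

text \<open>Vanishing of all minors means that the coefficient matrix has rank at most one.\<close>

lemma concurrence_sq_eq_0_iff: "concurrence_sq \<psi> = 0 \<longleftrightarrow> (\<exists>x y. \<psi> = tensor_vec x y)"
proof
  assume "concurrence_sq \<psi> = 0"
  then have minor: "\<psi> $ (a, b) * \<psi> $ (a', b') = \<psi> $ (a', b) * \<psi> $ (a, b')" for a a' b b'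
    by (simp add: concurrence_sq_eq_0_iff_minors minor_def)
  show "\<exists>x y. \<psi> = tensor_vec x y"
  proof (cases "\<psi> = 0")
    case True
    then have "\<psi> = tensor_vec 0 0"
      by (simp add: tensor_vec_def vec_eq_iff)
    then show ?thesis by blast
  next
    case False
    then obtain a b where ab: "\<psi> $ (a, b) \<noteq> 0"
      by (auto simp: vec_eq_iff)
    \<comment> \<open>Pivot on the nonzero entry: its column times its row, divided by the entry
      itself. The vanishing minors through the pivot recover every other entry.\<close>
    have "\<psi> = tensor_vec (\<chi> a'. \<psi> $ (a', b)) (\<chi> b'. \<psi> $ (a, b') / \<psi> $ (a, b))"
      using ab minor[of a b] by (simp add: tensor_vec_def vec_eq_iff field_simps)
    then show ?thesis by blast
  qed
next
  assume "\<exists>x y. \<psi> = tensor_vec x y"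
  then show "concurrence_sq \<psi> = 0"
    by (auto simp: concurrence_sq_eq_0_iff_minors minor_def tensor_vec_def)
qed

section \<open>Skew-symmetric projectors and the quartic form\<close>

lemma sum_skew_projector:
  fixes f :: "'k::finite \<times> 'k \<Rightarrow> complex"
  shows "(\<Sum>q\<in>UNIV. skew_projector $ p $ q * f q) = (f p - f (prod.swap p)) / 2"
proof -
  have swap: "q = prod.swap p \<longleftrightarrow> p = prod.swap q" for q :: "'k \<times> 'k"
    by (metis swap_swap)
  \<comment> \<open>Uniqueness of orthogonal projectors turns the definite description into the
    explicit matrix, half of identity minus swap.\<close>
  have entries: "(skew_projector :: complex^('k \<times> 'k)^('k \<times> 'k)) =
      (\<chi> p q. ((if p = q then 1 else 0) - (if p = prod.swap q then 1 else 0)) / 2)"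
    by (rule orth_projector_onto_unique[OF orth_projector_onto_skew_projector
          orth_projector_onto_skew_subspace])
  have entry: "skew_projector $ p $ q =
      ((if q = p then 1 else 0) - (if q = prod.swap p then 1 else 0)) / 2" for q
    unfolding swap[of q] entries vec_lambda_beta by (subst eq_commute[of q p]) (rule refl)
  have "skew_projector $ p $ q * f q =
      (if q = p then f q / 2 else 0) - (if q = prod.swap p then f q / 2 else 0)" for q
    unfolding entry by simp
  then have "(\<Sum>q\<in>UNIV. skew_projector $ p $ q * f q) =
      (\<Sum>q\<in>UNIV. (if q = p then f q / 2 else 0) - (if q = prod.swap p then f q / 2 else 0))"
    by (simp only:)
  also have "\<dots> = f p / 2 - f (prod.swap p) / 2"
    by (simp only: sum_subtractf sum.delta finite UNIV_I if_True)
  finally show ?thesis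
    by (simp only: diff_divide_distrib)
qed

lemma tensor_skew_projector_mult_vec:
  "((tensor_mat skew_projector skew_projector ::
        complex^(('m::finite \<times> 'm) \<times> ('n::finite \<times> 'n))^(('m \<times> 'm) \<times> ('n \<times> 'n))) *v v) $ (p, q) =
    (v $ (p, q) - v $ (p, prod.swap q)
      - v $ (prod.swap p, q) + v $ (prod.swap p, prod.swap q)) / 4"
proof -
  have "((tensor_mat skew_projector skew_projector ::
        complex^(('m::finite \<times> 'm) \<times> ('n::finite \<times> 'n))^(('m \<times> 'm) \<times> ('n \<times> 'n))) *v v) $ (p, q) =
     (\<Sum>p'\<in>UNIV. skew_projector $ p $ p' * (\<Sum>q'\<in>UNIV. skew_projector $ q $ q' * v $ (p', q')))"
    by (simp only: matrix_vector_mult_def tensor_mat_def sum_UNIV_prod[where ?f = "\<lambda>r. _ r * _ r"]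
      vec_lambda_beta sum_distrib_left mult.assoc fst_conv snd_conv)
  then show ?thesis
    unfolding sum_skew_projector by (simp add: diff_divide_distrib add_divide_distrib)
qed

text \<open>Swapping both index pairs at once fixes the reordered square of \<psi>, so the four
  signed terms of the projection coincide in pairs and each component becomes half a minor.\<close>

lemma cinner_skew_tensor_square:
  "cinner (reorder (tensor_vec \<psi> \<psi>))
     (tensor_mat skew_projector skew_projector *v reorder (tensor_vec \<psi> \<psi>)) =
   concurrence_sq \<psi> / 2"
proof -
  let ?v = "reorder (tensor_vec \<psi> \<psi>)"
  have v: "?v $ ((a, a'), (b, b')) = \<psi> $ (a, b) * \<psi> $ (a', b')" for a a' b b'
    by (simp add: reorder_def tensor_vec_def)
  have "cinner ?v (tensor_mat skew_projector skew_projector *v ?v) =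
    (\<Sum>p\<in>UNIV. \<Sum>q\<in>UNIV. cnj (?v $ (p, q)) * ((?v $ (p, q) - ?v $ (p, prod.swap q)
      - ?v $ (prod.swap p, q) + ?v $ (prod.swap p, prod.swap q)) / 4))"
    by (simp only: cinner_def sum_UNIV_prod[where ?f = "\<lambda>r. _ r * _ r"]
      tensor_skew_projector_mult_vec)
  also have "\<dots> = (\<Sum>a\<in>UNIV. \<Sum>a'\<in>UNIV. \<Sum>b\<in>UNIV. \<Sum>b'\<in>UNIV.
      cnj (\<psi> $ (a, b) * \<psi> $ (a', b')) * minor \<psi> a a' b b' / 2)"
    unfolding sum_UNIV_prod v swap_simp minor_def
    by (intro sum.cong refl) (simp add: field_simps)
  finally show ?thesis
    by (simp add: concurrence_sq_eq_sum sum_divide_distrib)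
qed

lemma reorder_tensor_ensemble_vec:
  "reorder (tensor_vec (ensemble_vec e r z i) (ensemble_vec e r z i)) =
    (\<Sum>\<mu><r. \<Sum>\<nu><r. (z i \<mu> * z i \<nu>) *s reorder (tensor_vec (e \<mu>) (e \<nu>)))"
  by (simp add: vec_eq_iff reorder_def tensor_vec_def ensemble_vec_def sum_product ac_simps)

text \<open>The factor 8 is 2 times 4: the half in \<open>cinner_skew_tensor_square\<close> and the
  quarter in \<open>E_coeff\<close>.\<close>

lemma quartic_form_eq_concurrence_sq:
  "8 * (\<Sum>\<alpha><r. \<Sum>\<beta><r. \<Sum>\<mu><r. \<Sum>\<nu><r.
       cnj (z i \<alpha>) * cnj (z i \<beta>) * E_coeff e \<alpha> \<beta> \<mu> \<nu> * z i \<mu> * z i \<nu>) =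
   concurrence_sq (ensemble_vec e r z i)"
proof -
  define \<psi> where "\<psi> = ensemble_vec e r z i"
  have "concurrence_sq \<psi> / 2 = (\<Sum>\<alpha><r. \<Sum>\<beta><r. \<Sum>\<mu><r. \<Sum>\<nu><r.
       cnj (z i \<alpha> * z i \<beta>) * (z i \<mu> * z i \<nu>) * (4 * E_coeff e \<alpha> \<beta> \<mu> \<nu>))"
    unfolding cinner_skew_tensor_square[symmetric] \<psi>_def reorder_tensor_ensemble_vec
    unfolding cinner_sum_left cinner_scale_left
    by (simp add: mat_mult_vec_sum vec.scale cinner_sum_right cinner_scale_right
      E_coeff_def sum_distrib_left ac_simps)
  also have "\<dots> = 4 * (\<Sum>\<alpha><r. \<Sum>\<beta><r. \<Sum>\<mu><r. \<Sum>\<nu><r.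
       cnj (z i \<alpha>) * cnj (z i \<beta>) * E_coeff e \<alpha> \<beta> \<mu> \<nu> * z i \<mu> * z i \<nu>)"
    by (simp add: sum_distrib_left ac_simps)
  finally show ?thesis
    by (simp add: \<psi>_def)
qed

lemma E_concurrence_eq_quartic: "E_concurrence e r z = 8 * E_quartic e r z"
  unfolding E_concurrence_def E_quartic_def
  by (subst sum_distrib_left) (intro sum.cong refl quartic_form_eq_concurrence_sq[symmetric])

text \<open>By the formula with minors every summand is a nonnegative real, so the terms cannot
  cancel and each one has to vanish.\<close>

lemma E_concurrence_eq_0_iff:
  fixes e :: "nat \<Rightarrow> complex^('m::finite \<times> 'n::finite)"
  shows "E_concurrence e r z = 0 \<longleftrightarrow>
    (\<forall>i < CARD('m)\<^sup>2 * CARD('n)\<^sup>2. \<exists>x y. ensemble_vec e r z i = tensor_vec x y)"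
proof -
  have "E_concurrence e r z = 0 \<longleftrightarrow>
    (\<forall>i < CARD('m)\<^sup>2 * CARD('n)\<^sup>2. concurrence_sq (ensemble_vec e r z i) = 0)"
    unfolding E_concurrence_def concurrence_sq_eq_minors of_real_sum[symmetric] of_real_eq_0_iff
    by (subst sum_nonneg_eq_0_iff) (auto intro!: sum_nonneg)
  then show ?thesis
    by (simp add: concurrence_sq_eq_0_iff)
qed

section \<open>Ensembles of a Hermitian matrix\<close>

text \<open>The inner product of one member with a vanishing combination isolates the coefficient of
  that member.\<close>

lemma independent_if_orthogonal:
  assumes "finite B" "0 \<notin> B" "pairwise (\<lambda>x y. cinner x y = 0) B"
  shows "vec.independent B"
proof (rule vec.independent_if_scalars_zero[OF assms(1)])
  fix f x
  assume 0: "(\<Sum>y\<in>B. f y *s y) = 0" and x: "x \<in> B"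
  have "(\<Sum>y\<in>B. f y * cinner x y) = (\<Sum>y\<in>B. if y = x then f y * cinner x y else 0)"
    using assms(3) x by (intro sum.cong) (auto simp: pairwise_def)
  also have "\<dots> = f x * cinner x x"
    using assms(1) x by simp
  finally have "f x * cinner x x = cinner x (\<Sum>y\<in>B. f y *s y)"
    by (simp add: cinner_sum_right cinner_scale_right)
  then show "f x = 0"
    using 0 x assms(2) cinner_self_eq_0_iff[of x] by auto
qed

text \<open>That the vectors \<open>e \<alpha>\<close> exhaust the image of \<rho> is encoded as
  \<open>rank \<rho> = r\<close>. Their squared norms form the diagonal case of
  \<open>orthogonal\<close>.\<close>

locale eigenensemble =
  fixes \<rho> :: "complex^'k^'k" and r :: nat and e :: "nat \<Rightarrow> complex^'k" and l :: "nat \<Rightarrow> complex"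
  assumes hermitian: "hermitian_mat \<rho>"
    and rank: "rank \<rho> = r"
    and eigen: "\<alpha> < r \<Longrightarrow> \<rho> *v e \<alpha> = l \<alpha> *s e \<alpha>"
    and nonzero: "\<alpha> < r \<Longrightarrow> l \<alpha> \<noteq> 0"
    and orthogonal: "\<alpha> < r \<Longrightarrow> \<beta> < r \<Longrightarrow> cinner (e \<alpha>) (e \<beta>) = (if \<alpha> = \<beta> then l \<alpha> else 0)"
begin

lemma cnj_eigenvalue: "\<alpha> < r \<Longrightarrow> cnj (l \<alpha>) = l \<alpha>"
  using cnj_cinner[of "e \<alpha>" "e \<alpha>"] by (simp add: orthogonal)

text \<open>
  For matrices over a general field \<^const>\<open>rank\<close> is the dimension of the row space, and the rows of
  \<open>\<rho>\<close> are the conjugates of its columns; so the argument runs with the conjugated eigenvectors.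
\<close>

lemma orthogonal_imp_kernel:
  assumes "\<And>\<alpha>. \<alpha> < r \<Longrightarrow> cinner (e \<alpha>) v = 0"
  shows "\<rho> *v v = 0"
proof -
  define c where "c \<alpha> = (\<chi> i. cnj (e \<alpha> $ i))" for \<alpha>
  define B where "B = c ` {..<r}"
  have \<rho>: "\<rho> $ j $ i = cnj (\<rho> $ i $ j)" for i j
    using hermitian by (auto simp: hermitian_mat_def adjoint_mat_def vec_eq_iff)
  have ortho: "cinner (c \<alpha>) (c \<beta>) = (if \<alpha> = \<beta> then l \<alpha> else 0)" if "\<alpha> < r" "\<beta> < r" for \<alpha> \<beta>
  proof -
    have "cinner (c \<alpha>) (c \<beta>) = cinner (e \<beta>) (e \<alpha>)"
      by (simp add: c_def cinner_def mult.commute)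
    then show ?thesis
      using that by (simp add: orthogonal)
  qed
  have "c \<alpha> \<noteq> c \<beta>" if "\<alpha> < r" "\<beta> < r" "\<alpha> \<noteq> \<beta>" for \<alpha> \<beta>
    using ortho[of \<alpha> \<beta>] ortho[of \<alpha> \<alpha>] nonzero[of \<alpha>] that by auto
  then have "inj_on c {..<r}"
    by (auto simp: inj_on_def)
  then have card: "card B = r"
    by (simp add: B_def card_image)
  have "c \<alpha> \<noteq> 0" if "\<alpha> < r" for \<alpha>
    using ortho[of \<alpha> \<alpha>] nonzero[of \<alpha>] that by auto
  then have indep: "vec.independent B"
    by (intro independent_if_orthogonal) (auto simp: B_def pairwise_def ortho)
  have "B \<subseteq> vec.span (rows \<rho>)"
  proof
    fix b assume "b \<in> B"
    then obtain \<alpha> where \<alpha>: "\<alpha> < r" "b = c \<alpha>"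
      by (auto simp: B_def)
    have "(transpose \<rho> *v c \<alpha>) $ i = cnj ((\<rho> *v e \<alpha>) $ i)" for i
      by (simp add: matrix_vector_mult_def transpose_def c_def \<rho>[of i])
    then have "transpose \<rho> *v c \<alpha> = l \<alpha> *s c \<alpha>"
      using \<alpha> by (simp add: vec_eq_iff eigen cnj_eigenvalue c_def)
    \<comment> \<open>Dividing by the nonzero eigenvalue exhibits \<open>b\<close> in the column
      space of \<open>transpose \<rho>\<close>, which is the row space of \<rho>.\<close>
    then have "b = transpose \<rho> *v ((1 / l \<alpha>) *s c \<alpha>)"
      using \<alpha> nonzero[of \<alpha>] by (simp add: vec.scale vector_smult_assoc)
    then show "b \<in> vec.span (rows \<rho>)"
      using matrix_vector_mult_in_columnspace_gen[of "transpose \<rho>"] by simp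
  qed
  \<comment> \<open>The row space has dimension \<open>r\<close>, so \<open>r\<close> independent
    vectors in it already span it.\<close>
  then have "vec.span (rows \<rho>) \<subseteq> vec.span B"
    by (rule vec.card_ge_dim_independent[OF _ indep])
      (use rank in \<open>simp add: card row_rank_def_gen\<close>)
  then have row: "row i \<rho> \<in> vec.span B" for i
    using vec.span_base[of "row i \<rho>" "rows \<rho>"] by (auto simp: rows_def)
  \<comment> \<open>This sum carries no conjugation: at \<open>c \<alpha>\<close> it equals
    \<open>cinner (e \<alpha>) v\<close>, and at row \<open>i\<close> of \<rho> it is component
    \<open>i\<close> of \<open>\<rho> *v v\<close>.\<close>
  have "(\<Sum>j\<in>UNIV. w $ j * v $ j) = 0" if "w \<in> vec.span B" for w
    using that
  proof (rule vec.span_induct)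
    show "vec.subspace {w. (\<Sum>j\<in>UNIV. w $ j * v $ j) = 0}"
      by (simp add: vec.subspace_def sum.distrib algebra_simps flip: sum_distrib_left)
    show "(\<Sum>j\<in>UNIV. w $ j * v $ j) = 0" if "w \<in> B" for w
      using that assms by (auto simp: B_def c_def cinner_def)
  qed
  from this[OF row] show ?thesis
    by (simp add: matrix_vector_mult_def vec_eq_iff row_def)
qed

text \<open>The subtracted sum is the orthogonal projection of \<open>v\<close> onto the span of the
  \<open>e \<alpha>\<close>; division by \<open>l \<alpha>\<close> accounts for their squared
  norms.\<close>

lemma residual:
  fixes v
  defines "w \<equiv> v - (\<Sum>\<alpha><r. (cinner (e \<alpha>) v / l \<alpha>) *s e \<alpha>)"
  shows "\<alpha> < r \<Longrightarrow> cinner (e \<alpha>) w = 0" "\<rho> *v w = 0"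
proof -
  show *: "cinner (e \<alpha>) w = 0" if "\<alpha> < r" for \<alpha>
  proof -
    have "(\<Sum>\<beta><r. cinner (e \<beta>) v / l \<beta> * cinner (e \<alpha>) (e \<beta>)) =
        (\<Sum>\<beta><r. if \<beta> = \<alpha> then cinner (e \<beta>) v else 0)"
      using that nonzero by (intro sum.cong) (auto simp: orthogonal)
    then show ?thesis
      using that by (simp add: w_def cinner_diff_right cinner_sum_right cinner_scale_right)
  qed
  show "\<rho> *v w = 0"
    by (rule orthogonal_imp_kernel[OF *])
qed

text \<open>By \<open>residual\<close>, \<rho> sees only the projection of \<open>v\<close>, and the
  eigenvalues it produces cancel the divisions by \<open>l \<alpha>\<close>.\<close>

lemma eq_sum_ketbra: "\<rho> = (\<Sum>\<alpha><r. ketbra (e \<alpha>))"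
proof -
  have "\<rho> *v v = (\<Sum>\<alpha><r. ketbra (e \<alpha>)) *v v" for v
  proof -
    have "\<rho> *v v = (\<Sum>\<alpha><r. (cinner (e \<alpha>) v / l \<alpha>) *s (\<rho> *v e \<alpha>))"
      using residual(2)[of v]
      by (simp add: matrix_vector_mult_diff_distrib mat_mult_vec_sum vec.scale)
    also have "\<dots> = (\<Sum>\<alpha><r. cinner (e \<alpha>) v *s e \<alpha>)"
      using nonzero by (intro sum.cong refl) (simp add: eigen vector_smult_assoc)
    finally show ?thesis
      by (simp add: sum_mat_mult_vec ketbra_mult_vec)
  qed
  then show ?thesis
    by (simp add: matrix_eq)
qed

text \<open>Since the columns of \<open>z\<close> are orthonormal, summing over \<open>i\<close>
  removes the mixed terms in the \<open>e \<alpha>\<close> and leaves the eigenensemble.\<close>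

lemma eq_sum_ketbra_ensemble_vec:
  assumes "\<And>\<alpha> \<beta>. \<alpha> < r \<Longrightarrow> \<beta> < r \<Longrightarrow>
    (\<Sum>i<M. cnj (z i \<alpha>) * z i \<beta>) = (if \<alpha> = \<beta> then 1 else 0)"
  shows "\<rho> = (\<Sum>i<M. ketbra (ensemble_vec e r z i))"
proof -
  have "(\<Sum>i<M. ketbra (ensemble_vec e r z i)) $ p $ q = \<rho> $ p $ q" for p q
  proof -
    have "(\<Sum>i<M. ketbra (ensemble_vec e r z i)) $ p $ q =
        (\<Sum>i<M. \<Sum>\<alpha><r. \<Sum>\<beta><r. cnj (z i \<beta>) * z i \<alpha> * (e \<alpha> $ p * cnj (e \<beta> $ q)))"
      by (simp add: ketbra_def ensemble_vec_def sum_product ac_simps)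
    also have "\<dots> = (\<Sum>\<alpha><r. \<Sum>\<beta><r. \<Sum>i<M. cnj (z i \<beta>) * z i \<alpha> * (e \<alpha> $ p * cnj (e \<beta> $ q)))"
      by (subst sum.swap, subst (2) sum.swap) rule
    also have "\<dots> = (\<Sum>\<alpha><r. \<Sum>\<beta><r. if \<beta> = \<alpha> then e \<alpha> $ p * cnj (e \<beta> $ q) else 0)"
      by (intro sum.cong refl) (simp add: assms flip: sum_distrib_right)
    also have "\<dots> = (\<Sum>\<alpha><r. ketbra (e \<alpha>)) $ p $ q"
      by (simp add: ketbra_def)
    finally show ?thesis
      by (simp only: eq_sum_ketbra[symmetric])
  qed
  then show ?thesis
    by (simp add: vec_eq_iff)
qed

text \<open>The entries of \<open>z\<close> are the coefficients of the projection of
  \<open>\<psi> i\<close> onto the span of the \<open>e \<alpha>\<close>. The first claim thus says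
  that \<open>\<psi> i\<close> lies in this span.\<close>

lemma ensemble_vec_of_sum_ketbra:
  fixes M :: nat
  assumes \<rho>: "\<rho> = (\<Sum>i<M. ketbra (\<psi> i))"
  defines "z \<equiv> \<lambda>i \<alpha>. cinner (e \<alpha>) (\<psi> i) / l \<alpha>"
  shows "i < M \<Longrightarrow> ensemble_vec e r z i = \<psi> i"
    and "\<alpha> < r \<Longrightarrow> \<beta> < r \<Longrightarrow> (\<Sum>i<M. cnj (z i \<alpha>) * z i \<beta>) = (if \<alpha> = \<beta> then 1 else 0)"
proof -
  have form: "cinner v (\<rho> *v u) = (\<Sum>i<M. cinner v (\<psi> i) * cinner (\<psi> i) u)" for v u
    by (simp add: \<rho> sum_mat_mult_vec ketbra_mult_vec cinner_sum_right cinner_scale_right mult.commute)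
  show "ensemble_vec e r z i = \<psi> i" if i: "i < M"
  proof -
    define w where "w = \<psi> i - ensemble_vec e r z i"
    have w: "\<rho> *v w = 0" "\<And>\<alpha>. \<alpha> < r \<Longrightarrow> cinner (e \<alpha>) w = 0"
      using residual[where v = "\<psi> i"] by (simp_all add: w_def ensemble_vec_def z_def)
    \<comment> \<open>As \<open>\<rho> *v w = 0\<close>, the squared moduli of all
      \<open>cinner w (\<psi> j)\<close> sum to 0, so \<open>w\<close> is orthogonal to
      \<open>\<psi> i\<close>. It is also orthogonal to the span, hence to itself.\<close>
    have "cinner w (\<psi> j) * cinner (\<psi> j) w = complex_of_real ((cmod (cinner w (\<psi> j)))\<^sup>2)" for j
      by (simp only: complex_norm_square cnj_cinner)
    then have "complex_of_real (\<Sum>j<M. (cmod (cinner w (\<psi> j)))\<^sup>2) = cinner w (\<rho> *v w)"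
      by (simp add: form)
    then have "(\<Sum>j<M. (cmod (cinner w (\<psi> j)))\<^sup>2) = 0"
      unfolding w cinner_zero_right of_real_eq_0_iff .
    then have "cinner w (\<psi> i) = 0"
      using i by (simp add: sum_nonneg_eq_0_iff)
    moreover have "cinner w (e \<alpha>) = 0" if "\<alpha> < r" for \<alpha>
      using w(2)[OF that] cnj_cinner[of "e \<alpha>" w] by simp
    then have "cinner w (ensemble_vec e r z i) = 0"
      by (simp add: ensemble_vec_def cinner_sum_right cinner_scale_right)
    ultimately have "cinner w w = 0"
      by (subst (2) w_def) (simp add: cinner_diff_right)
    then show ?thesis
      by (simp add: cinner_self_eq_0_iff w_def)
  qed
  show "(\<Sum>i<M. cnj (z i \<alpha>) * z i \<beta>) = (if \<alpha> = \<beta> then 1 else 0)" if "\<alpha> < r" "\<beta> < r"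
  proof -
    \<comment> \<open>Conjugating \<open>z i \<alpha>\<close> reverses its inner product, so the sum
      over \<open>i\<close> becomes the matrix element of \<rho> between \<open>e \<beta>\<close>
      and \<open>e \<alpha>\<close>.\<close>
    have "(\<Sum>i<M. cnj (z i \<alpha>) * z i \<beta>) =
        (\<Sum>i<M. cinner (e \<beta>) (\<psi> i) * cinner (\<psi> i) (e \<alpha>)) / (l \<alpha> * l \<beta>)"
      using that by (simp add: z_def cnj_cinner cnj_eigenvalue sum_divide_distrib mult.commute)
    also have "\<dots> = l \<alpha> * cinner (e \<beta>) (e \<alpha>) / (l \<alpha> * l \<beta>)"
      using that by (simp add: form[symmetric] eigen cinner_scale_right)
    finally show ?thesis
      using that nonzero by (simp add: orthogonal)
  qed
qed

end

section \<open>Separable decompositions of bounded length\<close>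

text \<open>Multiplication by \<open>\<i>\<close> yields a second real subspace of equal dimension
  that meets the Hermitian matrices only in 0; both fit into a space of real dimension
  \<open>2 * CARD('k) * CARD('k)\<close>.\<close>

lemma dim_hermitian_le: "dim {M :: complex^'k^'k. hermitian_mat M} \<le> CARD('k)\<^sup>2"
proof -
  let ?H = "{M :: complex^'k^'k. hermitian_mat M}"
  define J :: "complex^'k^'k \<Rightarrow> complex^'k^'k" where "J M = (\<chi> i j. \<i> * M $ i $ j)" for M
  have herm: "M \<in> ?H \<longleftrightarrow> (\<forall>i j. cnj (M $ j $ i) = M $ i $ j)" for M
    by (simp add: hermitian_mat_def adjoint_mat_def vec_eq_iff)
  have "?H = {M. \<forall>i j. cnj (M $ j $ i) = M $ i $ j}"
    using herm by blast
  then have sub: "subspace ?H"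
    by (simp add: subspace_def)
  have J: "linear J"
    by (rule linearI) (simp_all add: J_def vec_eq_iff algebra_simps)
  have "inj J"
    by (auto simp: inj_def J_def vec_eq_iff)
  then have dimJ: "dim (J ` ?H) = dim ?H"
    by (intro eucl.dim_image_eq J) (auto intro: inj_on_subset)
  have "?H \<inter> J ` ?H \<subseteq> {0}"
  proof
    fix M assume "M \<in> ?H \<inter> J ` ?H"
    then obtain N where N: "N \<in> ?H" "M = J N" "M \<in> ?H"
      by auto
    \<comment> \<open>Both \<open>M\<close> and \<open>N\<close> are Hermitian and
      \<open>M = J N\<close>; conjugation reverses the sign of the factor
      \<open>\<i>\<close>.\<close>
    have "M $ i $ j = - (M $ i $ j)" for i j
    proof -
      have "cnj (M $ j $ i) = M $ i $ j" "cnj (N $ j $ i) = N $ i $ j"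
        using N unfolding herm by auto
      then show ?thesis
        using N(2) by (simp add: J_def)
    qed
    then show "M \<in> {0}"
      by (simp add: vec_eq_iff)
  qed
  then have "dim (?H \<inter> J ` ?H) = 0"
    by simp
  then have "2 * dim ?H = dim {x + y |x y. x \<in> ?H \<and> y \<in> J ` ?H}"
    using dim_sums_Int[OF sub linear_subspace_image[OF J sub]] dimJ by linarith
  also have "\<dots> \<le> DIM(complex^'k^'k)"
    by (rule dim_subset_UNIV)
  finally show ?thesis
    by (simp add: power2_eq_square)
qed

text \<open>The trace condition keeps 0 off the affine hull, so adjoining 0 raises the affine
  dimension by one; for a set containing 0 it is the linear dimension.\<close>

lemma aff_dim_hermitian_trace_1:
  fixes S :: "(complex^'k^'k) set"
  assumes S: "S \<subseteq> {M. hermitian_mat M \<and> trace M = 1}"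
  shows "aff_dim S + 1 \<le> int (CARD('k)\<^sup>2)"
proof -
  have "affine {M :: complex^'k^'k. trace M = 1}"
    by (auto simp: affine_def trace_add trace_scaleR simp flip: scaleR_add_left)
  then have "affine hull S \<subseteq> {M. trace M = 1}"
    using S by (intro hull_minimal) auto
  then have "0 \<notin> affine hull S"
    by (auto simp: trace_def)
  then have "aff_dim S + 1 = aff_dim (insert 0 S)"
    by (simp add: aff_dim_insert)
  also have "\<dots> = int (dim (insert 0 S))"
    by (intro aff_dim_zero hull_inc) simp
  also have "\<dots> \<le> int (dim {M :: complex^'k^'k. hermitian_mat M})"
    using S by (intro iffD2[OF of_nat_le_iff] dim_subset)
      (auto simp: hermitian_mat_def adjoint_mat_def vec_eq_iff)
  also have "\<dots> \<le> int (CARD('k)\<^sup>2)"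
    using dim_hermitian_le by (rule iffD2[OF of_nat_le_iff])
  finally show ?thesis .
qed

lemma tensor_vec_scaleR_left: "tensor_vec (c *\<^sub>R x) y = c *\<^sub>R tensor_vec x y"
  by (simp add: tensor_vec_def vec_eq_iff)

lemma tensor_vec_scaleR_right: "tensor_vec x (c *\<^sub>R y) = c *\<^sub>R tensor_vec x y"
  by (simp add: tensor_vec_def vec_eq_iff)

lemma tensor_vec_normalize:
  "\<exists>u v. norm u = 1 \<and> norm v = 1 \<and> tensor_vec x y = norm (tensor_vec x y) *\<^sub>R tensor_vec u v"
proof (cases "tensor_vec x y = 0")
  case True
  \<comment> \<open>The scalar on the right is the norm, here 0, so any unit vectors serve; a basis
    vector is taken in each factor.\<close>
  show ?thesis
    unfolding True by (intro exI[of _ "axis undefined 1"]) simp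
next
  case False
  then have "norm x \<noteq> 0" "norm y \<noteq> 0"
    using norm_tensor_vec[of x y] by auto
  then show ?thesis
    by (intro exI[of _ "x /\<^sub>R norm x"] exI[of _ "y /\<^sub>R norm y"])
      (simp add: norm_tensor_vec tensor_vec_scaleR_left tensor_vec_scaleR_right field_simps)
qed

text \<open>Since \<open>ketbra\<close> scales quadratically, unnormalized product vectors can
  absorb the probabilities. Conversely, their squared norms are probabilities because they sum to
  the trace.\<close>

lemma separable_state_iff:
  fixes \<rho> :: "complex^('m::finite \<times> 'n::finite)^('m \<times> 'n)"
  assumes "trace \<rho> = 1"
  shows "separable_state \<rho> \<longleftrightarrow>
    (\<exists>\<psi>. (\<forall>i < CARD('m)\<^sup>2 * CARD('n)\<^sup>2. \<exists>x y. \<psi> i = tensor_vec x y) \<and>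
      \<rho> = (\<Sum>i < CARD('m)\<^sup>2 * CARD('n)\<^sup>2. ketbra (\<psi> i)))"
    (is "_ \<longleftrightarrow> (\<exists>\<psi>. (\<forall>i < ?M. _ \<psi> i) \<and> _ \<psi>)")
proof
  assume "separable_state \<rho>"
  then obtain N p x y where
    norm: "\<And>i. i < N \<Longrightarrow> p i \<ge> 0 \<and> norm (x i :: complex^'m) = 1 \<and> norm (y i :: complex^'n) = 1"
    and p: "(\<Sum>i<N::nat. p i) = 1"
    and \<rho>: "\<rho> = (\<Sum>i<N. p i *\<^sub>R ketbra (tensor_vec (x i) (y i)))"
    by (auto simp: separable_state_def tensor_mat_ketbra)
  define S :: "(complex^('m \<times> 'n)^('m \<times> 'n)) set"
    where "S = {ketbra (tensor_vec x y) |x y. norm x = 1 \<and> norm y = 1}"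
  have S: "S \<subseteq> {M. hermitian_mat M \<and> trace M = 1}"
    by (auto simp: S_def hermitian_ketbra trace_ketbra norm_tensor_vec)
  have "\<rho> \<in> convex hull S"
    unfolding \<rho> using norm p
    by (intro convex_sum) (auto simp: S_def intro!: hull_inc)
  \<comment> \<open>Caratheodory's theorem in the affine hull of \<open>S\<close> needs at most
    \<open>aff_dim S + 1\<close> product projectors, which the dimension bound limits to
    \<open>?M\<close>.\<close>
  then obtain T u where T: "finite T" "T \<subseteq> S" "int (card T) \<le> aff_dim S + 1"
    and u: "\<And>A. A \<in> T \<Longrightarrow> 0 \<le> u A" and \<rho>T: "(\<Sum>A\<in>T. u A *\<^sub>R A) = \<rho>"
    unfolding convex_hull_caratheodory_aff_dim by auto
  have "int (card T) \<le> int ?M"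
    using T(3) aff_dim_hermitian_trace_1[OF S] by (simp add: power_mult_distrib)
  then have card: "card T \<le> ?M"
    by (simp only: of_nat_le_iff)
  obtain h where h: "bij_betw h {..<card T} T"
    using ex_bij_betw_nat_finite[OF T(1)] by (auto simp: atLeast0LessThan)
  have "\<forall>A\<in>T. \<exists>v w. A = ketbra (tensor_vec v w)"
    using T(2) unfolding S_def by blast
  then obtain v w where vw: "\<And>A. A \<in> T \<Longrightarrow> A = ketbra (tensor_vec (v A) (w A))"
    by metis
  \<comment> \<open>The square root of each weight goes into the first factor. The zero vector,
    itself a product, pads the list to length exactly \<open>?M\<close>.\<close>
  define \<psi> where
    "\<psi> i = (if i < card T then tensor_vec (sqrt (u (h i)) *\<^sub>R v (h i)) (w (h i)) else tensor_vec 0 0)"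
    for i
  have "(\<Sum>i<?M. ketbra (\<psi> i)) = (\<Sum>i<card T. ketbra (\<psi> i))"
    using card
    by (intro sum.mono_neutral_right) (auto simp: \<psi>_def ketbra_def tensor_vec_def vec_eq_iff)
  also have "\<dots> = (\<Sum>i<card T. u (h i) *\<^sub>R h i)"
    using bij_betwE[OF h] u vw
    by (intro sum.cong refl) (auto simp: \<psi>_def tensor_vec_scaleR_left ketbra_scaleR)
  also have "\<dots> = \<rho>"
    unfolding \<rho>T[symmetric] using sum.reindex_bij_betw[OF h] .
  finally have "\<rho> = (\<Sum>i<?M. ketbra (\<psi> i))" ..
  moreover have "\<forall>i < ?M. \<exists>x y. \<psi> i = tensor_vec x y"
    by (auto simp: \<psi>_def)
  ultimately show "\<exists>\<psi>. (\<forall>i < ?M. \<exists>x y. \<psi> i = tensor_vec x y) \<and> \<rho> = (\<Sum>i<?M. ketbra (\<psi> i))"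
    by blast
next
  assume "\<exists>\<psi>. (\<forall>i < ?M. \<exists>x y. \<psi> i = tensor_vec x y) \<and> \<rho> = (\<Sum>i<?M. ketbra (\<psi> i))"
  then obtain \<psi> where prod: "\<And>i. i < ?M \<Longrightarrow> \<exists>x y. \<psi> i = tensor_vec x y"
    and \<rho>: "\<rho> = (\<Sum>i<?M. ketbra (\<psi> i))"
    by blast
  have "\<forall>i. \<exists>u v. i < ?M \<longrightarrow>
      norm u = 1 \<and> norm v = 1 \<and> \<psi> i = norm (\<psi> i) *\<^sub>R tensor_vec u v"
    using prod tensor_vec_normalize by metis
  then obtain u v where uv: "\<And>i. i < ?M \<Longrightarrow> norm (u i) = 1 \<and> norm (v i) = 1 \<and>
      \<psi> i = norm (\<psi> i) *\<^sub>R tensor_vec (u i) (v i)"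
    by metis
  have "complex_of_real (\<Sum>i<?M. (norm (\<psi> i))\<^sup>2) = 1"
    using assms by (simp add: \<rho> trace_sum trace_ketbra)
  then have "(\<Sum>i<?M. (norm (\<psi> i))\<^sup>2) = 1"
    unfolding of_real_eq_1_iff .
  moreover have "\<rho> = (\<Sum>i<?M. (norm (\<psi> i))\<^sup>2 *\<^sub>R tensor_mat (ketbra (u i)) (ketbra (v i)))"
    unfolding \<rho> tensor_mat_ketbra ketbra_scaleR[symmetric]
    using uv by (intro sum.cong refl) auto
  ultimately show "separable_state \<rho>"
    unfolding separable_state_def using uv
    by (intro exI[of _ ?M] exI[of _ "\<lambda>i. (norm (\<psi> i))\<^sup>2"] exI[of _ u] exI[of _ v]) auto
qed

section \<open>Separability as solvability of the polynomial system\<close>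

theorem proposition2:
  fixes \<rho> :: "complex^('m::finite \<times> 'n::finite)^('m \<times> 'n)"
    and r :: nat
    and e :: "nat \<Rightarrow> complex^('m \<times> 'n)"
  assumes "is_state \<rho>"
    and "rank \<rho> = r"
    and "subnormalized_eigenensemble \<rho> r e"
  shows "(\<forall>z. E_concurrence e r z = 8 * E_quartic e r z) \<and>
    (separable_state \<rho> \<longleftrightarrow>
      (\<exists>z. E_concurrence e r z = 0 \<and>
        (\<forall>\<alpha><r. \<forall>\<beta><r.
          (\<Sum>i<CARD('m)\<^sup>2 * CARD('n)\<^sup>2. cnj (z i \<alpha>) * z i \<beta>) - (if \<alpha> = \<beta> then 1 else 0) = 0))) \<and>
    (separable_state \<rho> \<longleftrightarrow>
      (\<exists>z. E_quartic e r z = 0 \<and>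
        (\<forall>\<alpha><r. \<forall>\<beta><r.
          (\<Sum>i<CARD('m)\<^sup>2 * CARD('n)\<^sup>2. cnj (z i \<alpha>) * z i \<beta>) - (if \<alpha> = \<beta> then 1 else 0) = 0)))"
proof -
  let ?M = "CARD('m)\<^sup>2 * CARD('n)\<^sup>2"
  obtain l where l: "\<forall>\<alpha><r. l \<alpha> \<noteq> 0 \<and> \<rho> *v e \<alpha> = l \<alpha> *s e \<alpha> \<and> cinner (e \<alpha>) (e \<alpha>) = l \<alpha>"
    "\<forall>\<alpha><r. \<forall>\<beta><r. \<alpha> \<noteq> \<beta> \<longrightarrow> cinner (e \<alpha>) (e \<beta>) = 0"
    using assms(3) unfolding subnormalized_eigenensemble_def by blast
  interpret eigenensemble \<rho> r e l
    using assms l by unfold_locales (auto simp: is_state_def pos_semidef_def)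
  have "separable_state \<rho> \<longleftrightarrow>
      (\<exists>z. E_concurrence e r z = 0 \<and>
        (\<forall>\<alpha><r. \<forall>\<beta><r. (\<Sum>i<?M. cnj (z i \<alpha>) * z i \<beta>) = (if \<alpha> = \<beta> then 1 else 0)))"
    (is "_ \<longleftrightarrow> ?R")
  proof
    assume "separable_state \<rho>"
    then obtain \<psi> where prod: "\<forall>i < ?M. \<exists>x y. \<psi> i = tensor_vec x y"
      and \<rho>: "\<rho> = (\<Sum>i<?M. ketbra (\<psi> i))"
      using assms(1) by (auto simp: separable_state_iff is_state_def)
    \<comment> \<open>The witness is the coefficient array whose ensemble vectors are the given
      product vectors.\<close>
    show ?R
      using ensemble_vec_of_sum_ketbra[OF \<rho>] prod
      by (intro exI[of _ "\<lambda>i \<alpha>. cinner (e \<alpha>) (\<psi> i) / l \<alpha>"]) (simp add: E_concurrence_eq_0_iff)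
  next
    assume ?R
    then obtain z where "\<forall>i < ?M. \<exists>x y. ensemble_vec e r z i = tensor_vec x y"
      and "\<rho> = (\<Sum>i<?M. ketbra (ensemble_vec e r z i))"
      using eq_sum_ketbra_ensemble_vec unfolding E_concurrence_eq_0_iff by meson
    then show "separable_state \<rho>"
      using assms(1) by (auto simp: separable_state_iff is_state_def)
  qed
  moreover have "E_concurrence e r z = 0 \<longleftrightarrow> E_quartic e r z = 0" for z
    by (simp add: E_concurrence_eq_quartic)
  ultimately show ?thesis
    by (simp add: E_concurrence_eq_quartic)
qed

end
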